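(* Let $(G_k)_{k\in\mathbb{N}}$ be a family of $2$-optimal small-set expanders, where $G_k=(L_k\sqcup R_k;E_k)$ is left-regular of degree $d_k$, and put $n_k:=|L_k|$, $m_k:=|R_k|$. Assume that the sequence $\frac{m_k^2}{n_k}$ is bounded and that $m_k\to\infty$. Then for all $s\in\mathbb{N}$ with $s\ge 3$ and all $c\in\mathbb{R}$ with $c>1$ there is an index $k^*\in\mathbb{N}$ such that, for every $k\ge k^*$, the graph $G_k$ contains a bipartite subgraph $A_k$ with parts $L(A_k)\sqcup R(A_k)$, $L(A_k)\subseteq L_k$, $R(A_k)\subseteq R_k$, satisfying: (1) $A_k$ is left-regular of degree $d_k$; (2) $|L(A_k)|\ge c\,m_k\ge c\,|R(A_k)|$; (3) $A_k$ is an $s$-optimal small-set expander.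
   Context: Graphs are finite and simple. A bipartite graph $G$ with parts $L\sqcup R$ is left-regular of degree $d$ if every vertex of $L$ has exactly $d$ incident edges. For $X\subseteq L$, $N(X)\subseteq R$ is the set of vertices adjacent to at least one vertex of $X$. For an integer $1\le t\le |L|$, $$\alpha_G(t):=\min\left\{\frac{|N(X)|}{|X|}: X\subseteq L,\ 0<|X|\le t\right\}.$$ A left-regular bipartite graph $G$ of degree $d$ is an $s$-optimal small-set expander (for an integer $s\le |L|$) if $\alpha_G(t)\ge (d-1)+\frac1t$ for every integer $t$ with $1\le t\le s$. *)

theory Defs
  imports Complex_Main
begin

text \<open>
  Both parts live in one vertex type; edges are unordered pairs, so graphs are simple by
  construction. Isolated vertices and empty parts are permitted.
\<close>

record 'a bigraph =
  left :: "'a set"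
  right :: "'a set"
  edges :: "'a set set"

definition bipartite_graph :: "'a bigraph \<Rightarrow> bool" where
  "bipartite_graph G \<longleftrightarrow>
     finite (left G) \<and> finite (right G) \<and> left G \<inter> right G = {} \<and>
     (\<forall>e\<in>edges G. \<exists>u\<in>left G. \<exists>v\<in>right G. e = {u, v})"

definition bipartite_subgraph :: "'a bigraph \<Rightarrow> 'a bigraph \<Rightarrow> bool" where
  "bipartite_subgraph A G \<longleftrightarrow>
     bipartite_graph A \<and> left A \<subseteq> left G \<and> right A \<subseteq> right G \<and> edges A \<subseteq> edges G"

definition left_regular :: "'a bigraph \<Rightarrow> nat \<Rightarrow> bool" where
  "left_regular G d \<longleftrightarrow> (\<forall>u\<in>left G. card {e \<in> edges G. u \<in> e} = d)"

definition neighbourhood :: "'a bigraph \<Rightarrow> 'a set \<Rightarrow> 'a set" where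
  "neighbourhood G X = {v \<in> right G. \<exists>u\<in>X. {u, v} \<in> edges G}"

text \<open>
  Meaningful for \<open>1 \<le> t \<le> card (left G)\<close> only: the minimum then ranges over a finite
  nonempty set.
\<close>

definition expansion :: "'a bigraph \<Rightarrow> nat \<Rightarrow> real" where
  "expansion G t =
     Min {real (card (neighbourhood G X)) / real (card X) | X.
            X \<subseteq> left G \<and> 0 < card X \<and> card X \<le> t}"

text \<open>
  The degree \<open>d\<close> is a parameter, determined by \<open>G\<close> whenever \<open>left G\<close> is nonempty. The bound
  \<open>s \<le> card (left G)\<close> is part of the notion. The subtraction \<open>d - 1\<close> is taken in the reals.
\<close>

definition optimal_small_set_expander :: "'a bigraph \<Rightarrow> nat \<Rightarrow> nat \<Rightarrow> bool" where
  "optimal_small_set_expander G d s \<longleftrightarrow>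
     bipartite_graph G \<and> left_regular G d \<and> s \<le> card (left G) \<and>
     (\<forall>t. 1 \<le> t \<and> t \<le> s \<longrightarrow> expansion G t \<ge> (real d - 1) + 1 / real t)"

end

theory Submission
  imports Defs
begin

text \<open>
  View the left vertices as hyperedges on the right part. Being 2-optimal means that two hyperedges
  share at most one vertex, so a pair of vertices lies in at most one hyperedge. Being s-optimal
  means that any $x \le s$ hyperedges, $x > 0$, span at least $(d - 1) x + 1$ vertices.

  If $d \le 1$ the second property is automatic. Otherwise $m^2 \le C n$ forces $d \le C$. Take a
  maximal family $A$ with the second property and with vertex degrees at most a constant $D$. Any
  other hyperedge either meets a vertex of degree $D$ in $A$, or contains two vertices joined by a
  walk of bounded length in $A$. If $|A| < c m$, at most $d c m^2 / D \le n / 2$ hyperedges are of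
  the first kind, by double counting, and $O(m)$ are of the second kind, because walks from a given
  vertex reach boundedly many others. For large $m$ this is fewer than $n$ in total.
\<close>

section \<open>Linear hypergraphs and degree counts\<close>

lemma relpow_subset:
  fixes R S :: "('b \<times> 'b) set"
  shows "R \<subseteq> S \<Longrightarrow> R ^^ k \<subseteq> S ^^ k"
  by (induction k) auto

text \<open>Hyperedges are indices \<open>e\<close> with vertex sets \<open>N e\<close>, so distinct
  left vertices with the same neighbourhood stay distinct. Such vertices can occur when
  \<open>d \<le> 1\<close>.\<close>

locale linear_hypergraph =
  fixes E :: "'a set" and V :: "'b set" and N :: "'a \<Rightarrow> 'b set" and d :: nat
  assumes finE: "finite E" and finV: "finite V"
    and N_sub: "e \<in> E \<Longrightarrow> N e \<subseteq> V"
    and card_N: "e \<in> E \<Longrightarrow> card (N e) = d"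
    and linear: "e \<in> E \<Longrightarrow> f \<in> E \<Longrightarrow> e \<noteq> f \<Longrightarrow> card (N e \<inter> N f) \<le> 1"
begin

definition sparse :: "nat \<Rightarrow> 'a set \<Rightarrow> bool" where
  "sparse s A \<longleftrightarrow>
     (\<forall>X\<subseteq>A. X \<noteq> {} \<and> card X \<le> s \<longrightarrow> d * card X + 1 \<le> card (\<Union>(N ` X)) + card X)"

definition deg :: "'a set \<Rightarrow> 'b \<Rightarrow> nat" where
  "deg A v = card {e \<in> A. v \<in> N e}"

definition adj :: "'a set \<Rightarrow> ('b \<times> 'b) set" where
  "adj A = {(u, w). \<exists>e\<in>A. u \<in> N e \<and> w \<in> N e}"

lemma finN: "e \<in> E \<Longrightarrow> finite (N e)"
  using N_sub finV finite_subset by blast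

lemma eq_if_two_common:
  assumes "e \<in> E" "f \<in> E" "u \<noteq> w" "u \<in> N e" "w \<in> N e" "u \<in> N f" "w \<in> N f"
  shows "e = f"
proof (rule ccontr)
  assume "e \<noteq> f"
  have "card {u, w} \<le> card (N e \<inter> N f)"
    using assms finN by (intro card_mono) auto
  then show False
    using linear[OF assms(1,2) \<open>e \<noteq> f\<close>] \<open>u \<noteq> w\<close> by simp
qed

text \<open>Hyperedges through \<open>v\<close> meet pairwise only in \<open>v\<close>, so choosing
  a second vertex in each is injective. The second vertex exists because
  \<open>2 \<le> d\<close>.\<close>

lemma deg_le_card:
  assumes "2 \<le> d"
  shows "deg E v \<le> card V"
proof -
  have "\<exists>w. w \<in> N e - {v}" if "e \<in> E" for e
  proof (rule ccontr)
    assume "\<not> ?thesis"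
    then have "N e \<subseteq> {v}" by auto
    then have "card (N e) \<le> 1" using card_mono[of "{v}" "N e"] by simp
    then show False using card_N[OF that] assms by simp
  qed
  then obtain g where g: "\<And>e. e \<in> E \<Longrightarrow> g e \<in> N e - {v}" by metis
  show ?thesis unfolding deg_def
  proof (rule card_inj_on_le[of g])
    show "inj_on g {e \<in> E. v \<in> N e}"
    proof (rule inj_onI)
      fix e f assume ef: "e \<in> {e \<in> E. v \<in> N e}" "f \<in> {e \<in> E. v \<in> N e}" "g e = g f"
      then show "e = f"
        using g[of e] g[of f] by (intro eq_if_two_common[of e f v "g e"]) auto
    qed
    show "g ` {e \<in> E. v \<in> N e} \<subseteq> V" using g N_sub by blast
  qed (rule finV)
qed

lemma sum_deg:
  assumes "A \<subseteq> E"
  shows "(\<Sum>v\<in>V. deg A v) = d * card A"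
proof -
  have fA: "finite A" using assms finE finite_subset by blast
  have "(\<Sum>v\<in>V. deg A v) = (\<Sum>v\<in>V. \<Sum>e\<in>{e\<in>A. v \<in> N e}. 1)"
    by (simp add: deg_def)
  also have "\<dots> = (\<Sum>e\<in>A. \<Sum>v\<in>{v\<in>V. v \<in> N e}. 1)"
    by (rule sum.swap_restrict[OF finV fA])
  also have "\<dots> = (\<Sum>e\<in>A. d)"
  proof (rule sum.cong[OF refl])
    fix e assume "e \<in> A"
    then have "{v\<in>V. v \<in> N e} = N e" "card (N e) = d" using N_sub card_N assms by auto
    then show "(\<Sum>v\<in>{v\<in>V. v \<in> N e}. 1) = d" by simp
  qed
  finally show ?thesis by simp
qed

lemma card_E_le:
  assumes "2 \<le> d"
  shows "d * card E \<le> card V * card V"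
  using sum_mono[of V "deg E" "\<lambda>_. card V"] deg_le_card[OF assms] sum_deg[of E] by simp

text \<open>Markov's inequality for the degrees, whose sum is \<open>d * card A\<close>.\<close>

lemma card_saturated:
  assumes "A \<subseteq> E"
  shows "D * card {v \<in> V. D \<le> deg A v} \<le> d * card A"
proof -
  have "D * card {v \<in> V. D \<le> deg A v} = (\<Sum>v\<in>{v \<in> V. D \<le> deg A v}. D)" by simp
  also have "\<dots> \<le> (\<Sum>v\<in>{v \<in> V. D \<le> deg A v}. deg A v)" by (rule sum_mono) simp
  also have "\<dots> \<le> (\<Sum>v\<in>V. deg A v)" using finV by (intro sum_mono2) auto
  finally show ?thesis using sum_deg[OF assms] by simp
qed

text \<open>All of \<open>E\<close> is counted here, where a degree is bounded only by
  \<open>card V\<close>; the gain has to come from \<open>S\<close> being small.\<close>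

lemma card_meeting_le:
  assumes "2 \<le> d" "S \<subseteq> V"
  shows "card {e \<in> E. N e \<inter> S \<noteq> {}} \<le> card S * card V"
proof -
  have "finite S" using assms finV finite_subset by blast
  have "{e \<in> E. N e \<inter> S \<noteq> {}} = (\<Union>v\<in>S. {e\<in>E. v \<in> N e})" by auto
  then have "card {e \<in> E. N e \<inter> S \<noteq> {}} \<le> (\<Sum>v\<in>S. deg E v)"
    unfolding deg_def using card_UN_le[OF \<open>finite S\<close>] by simp
  also have "\<dots> \<le> (\<Sum>v\<in>S. card V)" by (rule sum_mono) (rule deg_le_card[OF assms(1)])
  finally show ?thesis by simp
qed

section \<open>Walks of bounded length and conflicts\<close>

lemma adj_subset: "A \<subseteq> E \<Longrightarrow> adj A \<subseteq> V \<times> V"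
  unfolding adj_def using N_sub by blast

lemma card_adj_Image_le:
  assumes "A \<subseteq> E"
  shows "card (adj A `` {u}) \<le> deg A u * d"
proof -
  have fA: "finite {e\<in>A. u \<in> N e}" using finite_subset[OF assms finE] by simp
  have "adj A `` {u} = (\<Union>e\<in>{e\<in>A. u \<in> N e}. N e)" by (auto simp: adj_def)
  then have "card (adj A `` {u}) \<le> (\<Sum>e\<in>{e\<in>A. u \<in> N e}. card (N e))"
    using card_UN_le[OF fA] by simp
  also have "\<dots> = (\<Sum>e\<in>{e\<in>A. u \<in> N e}. d)"
    using card_N assms by (intro sum.cong) auto
  finally show ?thesis by (simp add: deg_def)
qed

text \<open>Each step multiplies the number of endpoints by at most \<open>D * d\<close>.
  Containment in \<open>V\<close> is carried through the induction because the degree bound is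
  assumed only there.\<close>

lemma card_adj_pow_Image_le:
  assumes "A \<subseteq> E" and D: "\<And>v. v \<in> V \<Longrightarrow> deg A v \<le> D" and "u \<in> V"
  shows "(adj A ^^ k) `` {u} \<subseteq> V \<and> card ((adj A ^^ k) `` {u}) \<le> (D * d) ^ k"
proof (induction k)
  case 0
  then show ?case using \<open>u \<in> V\<close> by simp
next
  case (Suc k)
  let ?B = "(adj A ^^ k) `` {u}"
  have fB: "finite ?B" using Suc finV finite_subset by blast
  have eq: "(adj A ^^ Suc k) `` {u} = (\<Union>w\<in>?B. adj A `` {w})" by auto
  have "card ((adj A ^^ Suc k) `` {u}) \<le> (\<Sum>w\<in>?B. card (adj A `` {w}))"
    unfolding eq by (rule card_UN_le[OF fB])
  also have "\<dots> \<le> (\<Sum>w\<in>?B. D * d)"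
  proof (rule sum_mono)
    fix w assume "w \<in> ?B"
    then have "deg A w \<le> D" using Suc D by blast
    then show "card (adj A `` {w}) \<le> D * d"
      using card_adj_Image_le[OF assms(1), of w] mult_le_mono1 le_trans by blast
  qed
  also have "\<dots> = card ?B * (D * d)" by simp
  also have "\<dots> \<le> (D * d) ^ k * (D * d)" using Suc by (intro mult_le_mono1) blast
  finally have "card ((adj A ^^ Suc k) `` {u}) \<le> (D * d) ^ Suc k" by (simp add: mult.commute)
  moreover have "(adj A ^^ Suc k) `` {u} \<subseteq> V"
    unfolding eq using adj_subset[OF assms(1)] by blast
  ultimately show ?case by blast
qed

text \<open>Walks are cut off at length \<open>q\<close>: bounded degree bounds the reach of such
  walks, but not the size of a whole component.\<close>

definition conflict :: "nat \<Rightarrow> 'a set \<Rightarrow> 'a \<Rightarrow> bool" where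
  "conflict q A e \<longleftrightarrow>
     (\<exists>u\<in>N e. \<exists>w\<in>N e. u \<noteq> w \<and> (u, w) \<in> (\<Union>k\<in>{..q}. adj A ^^ k))"

text \<open>By linearity a hyperedge is determined by any two of its vertices, so a joined pair
  encodes a conflicting hyperedge. There are at most \<open>card V\<close> first vertices, each
  reaching boundedly many second ones.\<close>

lemma card_conflict_le:
  assumes "A \<subseteq> E" and D: "\<And>v. v \<in> V \<Longrightarrow> deg A v \<le> D"
  shows "card {e \<in> E. conflict q A e} \<le> card V * (\<Sum>k\<le>q. (D * d) ^ k)"
proof -
  define W where "W u = (\<Union>k\<in>{..q}. (adj A ^^ k) `` {u})" for u
  have W_sub: "W u \<subseteq> V" if "u \<in> V" for u
    using card_adj_pow_Image_le[OF assms(1) D that] unfolding W_def by blast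
  have card_W: "card (W u) \<le> (\<Sum>k\<le>q. (D * d) ^ k)" if "u \<in> V" for u
  proof -
    have "card (W u) \<le> (\<Sum>k\<le>q. card ((adj A ^^ k) `` {u}))"
      unfolding W_def by (rule card_UN_le) simp
    also have "\<dots> \<le> (\<Sum>k\<le>q. (D * d) ^ k)"
      using card_adj_pow_Image_le[OF assms(1) D that] by (intro sum_mono) blast
    finally show ?thesis .
  qed
  have "\<exists>u w. u \<in> N e \<and> w \<in> N e \<and> u \<noteq> w \<and> w \<in> W u" if "conflict q A e" for e
    using that unfolding conflict_def W_def by blast
  then obtain g h where gh: "\<And>e. conflict q A e \<Longrightarrow>
      g e \<in> N e \<and> h e \<in> N e \<and> g e \<noteq> h e \<and> h e \<in> W (g e)" by metis
  have "card {e \<in> E. conflict q A e} \<le> card (SIGMA u:V. W u)"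
  proof (rule card_inj_on_le[of "\<lambda>e. (g e, h e)"])
    show "inj_on (\<lambda>e. (g e, h e)) {e \<in> E. conflict q A e}"
    proof (rule inj_onI)
      fix e f assume ef: "e \<in> {e \<in> E. conflict q A e}" "f \<in> {e \<in> E. conflict q A e}"
        "(g e, h e) = (g f, h f)"
      then show "e = f"
        using gh[of e] gh[of f] by (intro eq_if_two_common[of e f "g e" "h e"]) auto
    qed
    show "(\<lambda>e. (g e, h e)) ` {e \<in> E. conflict q A e} \<subseteq> (SIGMA u:V. W u)"
      using gh N_sub by blast
    show "finite (SIGMA u:V. W u)"
      using finV W_sub finite_subset by (intro finite_SigmaI) blast+
  qed
  also have "\<dots> = (\<Sum>u\<in>V. card (W u))"
    using finV W_sub finite_subset by (intro card_SigmaI) blast+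
  also have "\<dots> \<le> (\<Sum>u\<in>V. \<Sum>k\<le>q. (D * d) ^ k)" by (intro sum_mono card_W)
  finally show ?thesis by simp
qed

section \<open>Extending a sparse family by one hyperedge\<close>

lemma card_adj_le:
  assumes "Y \<subseteq> E"
  shows "finite (adj Y)" "card (adj Y) \<le> card Y * (d * d)"
proof -
  show "finite (adj Y)" using adj_subset[OF assms] finV finite_subset by blast
  have fY: "finite Y" using assms finE finite_subset by blast
  have "adj Y = (\<Union>e\<in>Y. N e \<times> N e)" by (auto simp: adj_def)
  then have "card (adj Y) \<le> (\<Sum>e\<in>Y. card (N e \<times> N e))" using card_UN_le[OF fY] by simp
  also have "\<dots> = (\<Sum>e\<in>Y. d * d)"
    using card_N assms by (intro sum.cong) (auto simp: card_cartesian_product)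
  finally show "card (adj Y) \<le> card Y * (d * d)" by simp
qed

text \<open>In a finite relation, reachability needs no more steps than the relation has pairs. This
  turns connectedness in a small subfamily into a walk short enough to count as a conflict.\<close>

lemma rtrancl_adj_bounded:
  assumes "A \<subseteq> E" "Y \<subseteq> A" "card Y * (d * d) \<le> q" "(u, w) \<in> (adj Y)\<^sup>*"
  shows "(u, w) \<in> (\<Union>k\<in>{..q}. adj A ^^ k)"
proof -
  have "Y \<subseteq> E" using assms by blast
  have "(u, w) \<in> (\<Union>k\<in>{..card (adj Y)}. adj Y ^^ k)"
    using assms(4) rtrancl_finite_eq_relpow[OF card_adj_le(1)[OF \<open>Y \<subseteq> E\<close>]] by auto
  then obtain k where k: "k \<le> card (adj Y)" "(u, w) \<in> adj Y ^^ k" by auto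
  have "adj Y \<subseteq> adj A" using assms(2) unfolding adj_def by blast
  then have "(u, w) \<in> adj A ^^ k" using k(2) relpow_subset by blast
  moreover have "k \<le> q" using k(1) card_adj_le(2)[OF \<open>Y \<subseteq> E\<close>] assms(3) by linarith
  ultimately show ?thesis by blast
qed

text \<open>
  Let $Y$ be a subfamily of $A$, and for a vertex $u$ of $e$ let $C_u$ be the component of $Y$ at
  $u$. Without a conflict these are disjoint, and each nonempty one contributes the $+ 1$ that pays
  for the loss of $u$ when $e$ is added.
\<close>

lemma sparse_insert:
  assumes A: "A \<subseteq> E" and e: "e \<in> E" "e \<notin> A" and sp: "sparse s A"
    and nc: "\<not> conflict q A e" and q: "s * (d * d) \<le> q"
  shows "sparse s (insert e A)"
  unfolding sparse_def
proof (intro allI impI)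
  fix X assume X: "X \<subseteq> insert e A" "X \<noteq> {} \<and> card X \<le> s"
  have fX: "finite X" using X A finE finite_subset by (metis finite_insert)
  show "d * card X + 1 \<le> card (\<Union>(N ` X)) + card X"
  proof (cases "e \<in> X")
    case False
    then show ?thesis using X sp unfolding sparse_def by blast
  next
    case True
    define Y where "Y = X - {e}"
    have YA: "Y \<subseteq> A" and fY: "finite Y" and YE: "Y \<subseteq> E" using X A fX by (auto simp: Y_def)
    have X_eq: "X = insert e Y" using True by (auto simp: Y_def)
    have cX: "card X = Suc (card Y)" using card_Suc_Diff1[OF fX True] by (simp add: Y_def)
    have cY: "card Y \<le> s" using cX X by simp
    have fin_NN: "finite (\<Union>(N ` Z))" if "Z \<subseteq> E" for Z
      using finite_subset[OF that finE] that finN by blast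
    \<comment> \<open>\<open>U\<close> consists of the vertices lost to overlap when
      \<open>e\<close> is added. The hyperedges of \<open>Y\<close> split into the components
      \<open>C u\<close> attached to \<open>e\<close> and a remainder \<open>Z\<close> whose
      components miss \<open>e\<close>.\<close>
    define U where "U = N e \<inter> \<Union>(N ` Y)"
    define C where "C u = {f \<in> Y. \<exists>w\<in>N f. (u, w) \<in> (adj Y)\<^sup>*}" for u
    define Z where "Z = Y - (\<Union>u\<in>U. C u)"
    have adjI: "(v, w) \<in> (adj Y)\<^sup>*" if "f \<in> Y" "v \<in> N f" "w \<in> N f" for f v w
      using that unfolding adj_def by blast
    have NC: "(u, w) \<in> (adj Y)\<^sup>*" if "f \<in> C u" "w \<in> N f" for u f w
      using that adjI unfolding C_def by (blast intro: rtrancl_trans)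
    have sym: "(w, u) \<in> (adj Y)\<^sup>*" if "(u, w) \<in> (adj Y)\<^sup>*" for u w
    proof -
      have "sym (adj Y)" unfolding adj_def sym_def by blast
      then show ?thesis using that sym_rtrancl by (metis symD)
    qed
    have separated: "u = w" if "u \<in> N e" "w \<in> N e" "(u, w) \<in> (adj Y)\<^sup>*" for u w
    proof -
      have "card Y * (d * d) \<le> q" using cY q mult_le_mono1 le_trans by blast
      then show ?thesis
        using rtrancl_adj_bounded[OF A YA _ that(3)] nc that(1,2) unfolding conflict_def by blast
    qed
    have CY: "C u \<subseteq> Y" for u by (auto simp: C_def)
    have fU: "finite U" using finN[OF e(1)] by (simp add: U_def)
    have disjN: "\<Union>(N ` C u) \<inter> \<Union>(N ` C w) = {}" if "u \<in> U" "w \<in> U" "u \<noteq> w" for u w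
    proof (rule ccontr)
      assume "\<not> ?thesis"
      then obtain v where "v \<in> \<Union>(N ` C u)" "v \<in> \<Union>(N ` C w)" by blast
      then have "(u, v) \<in> (adj Y)\<^sup>*" "(v, w) \<in> (adj Y)\<^sup>*" using NC sym by blast+
      then show False using separated[of u w] that unfolding U_def by (auto intro: rtrancl_trans)
    qed
    have disjC: "C u \<inter> C w = {}" if "u \<in> U" "w \<in> U" "u \<noteq> w" for u w
    proof (rule ccontr)
      assume "\<not> ?thesis"
      then obtain f where f: "f \<in> C u" "f \<in> C w" by blast
      then obtain v where "v \<in> N f" unfolding C_def by blast
      then show False using disjN[OF that] f by blast
    qed
    have disjZ: "\<Union>(N ` Z) \<inter> (\<Union>u\<in>U. \<Union>(N ` C u)) = {}"
    proof (rule ccontr)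
      assume "\<not> ?thesis"
      then obtain v f u g where "f \<in> Z" "v \<in> N f" "u \<in> U" "g \<in> C u" "v \<in> N g" by blast
      then have "f \<in> C u" using NC[of g u v] unfolding C_def Z_def by blast
      then show False using \<open>f \<in> Z\<close> \<open>u \<in> U\<close> unfolding Z_def by blast
    qed
    have spY: "d * card X' + 1 \<le> card (\<Union>(N ` X')) + card X'" if "X' \<subseteq> Y" "X' \<noteq> {}" for X'
    proof -
      have "card X' \<le> s" using card_mono[OF fY that(1)] cY by simp
      then show ?thesis using sp that YA unfolding sparse_def by blast
    qed
    have C_ne: "C u \<noteq> {}" if "u \<in> U" for u
      using that unfolding U_def C_def by blast
    have "(\<Sum>u\<in>U. d * card (C u) + 1) \<le> (\<Sum>u\<in>U. card (\<Union>(N ` C u)) + card (C u))"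
      by (intro sum_mono spY CY C_ne)
    then have sumU: "d * (\<Sum>u\<in>U. card (C u)) + card U
        \<le> (\<Sum>u\<in>U. card (\<Union>(N ` C u))) + (\<Sum>u\<in>U. card (C u))"
      unfolding sum.distrib sum_distrib_left[symmetric] by simp
    \<comment> \<open>\<open>Z\<close> may be empty, so the \<open>+ 1\<close> is given up
      here.\<close>
    have sumZ: "d * card Z \<le> card (\<Union>(N ` Z)) + card Z"
    proof (cases "Z = {}")
      case False
      moreover have "Z \<subseteq> Y" by (auto simp: Z_def)
      ultimately show ?thesis using spY[of Z] by simp
    qed simp
    have cY_eq: "card Y = (\<Sum>u\<in>U. card (C u)) + card Z"
    proof -
      have "card (\<Union>u\<in>U. C u) = (\<Sum>u\<in>U. card (C u))"
        using fU finite_subset[OF CY fY] disjC by (intro card_UN_disjoint) auto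
      moreover have "card Y = card (\<Union>u\<in>U. C u) + card Z"
      proof -
        have sub: "(\<Union>u\<in>U. C u) \<subseteq> Y" using CY by blast
        then show ?thesis
          unfolding Z_def using card_Diff_subset[OF finite_subset[OF sub fY] sub] card_mono[OF fY sub]
          by simp
      qed
      ultimately show ?thesis by simp
    qed
    have cNY: "(\<Sum>u\<in>U. card (\<Union>(N ` C u))) + card (\<Union>(N ` Z)) \<le> card (\<Union>(N ` Y))"
    proof -
      have fC: "finite (\<Union>(N ` C u))" for u by (rule fin_NN) (use CY YE in blast)
      have fZ: "finite (\<Union>(N ` Z))" using fin_NN YE unfolding Z_def by blast
      have "(\<Sum>u\<in>U. card (\<Union>(N ` C u))) = card (\<Union>u\<in>U. \<Union>(N ` C u))"
        using fU fC disjN by (intro card_UN_disjoint[symmetric]) auto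
      also have "\<dots> + card (\<Union>(N ` Z)) = card ((\<Union>u\<in>U. \<Union>(N ` C u)) \<union> \<Union>(N ` Z))"
        using fU fC fZ disjZ by (intro card_Un_disjoint[symmetric]) auto
      also have "\<dots> \<le> card (\<Union>(N ` Y))"
        using CY by (intro card_mono fin_NN YE) (auto simp: Z_def)
      finally show ?thesis .
    qed
    have cNX: "card (\<Union>(N ` X)) + card U = d + card (\<Union>(N ` Y))"
    proof -
      have "card (N e) + card (\<Union>(N ` Y)) = card (N e \<union> \<Union>(N ` Y)) + card (N e \<inter> \<Union>(N ` Y))"
        by (intro card_Un_Int finN fin_NN e YE)
      then show ?thesis using card_N[OF e(1)] unfolding U_def X_eq by simp
    qed
    have "d * card Y = d * (\<Sum>u\<in>U. card (C u)) + d * card Z"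
      using cY_eq by (simp add: distrib_left)
    \<comment> \<open>The term \<open>card U\<close> cancels between \<open>sumU\<close> and
      \<open>cNX\<close>; the \<open>+ 1\<close> required for \<open>X\<close> comes from
      \<open>card X = Suc (card Y)\<close>.\<close>
    then show ?thesis using sumU sumZ cY_eq cNY cNX cX by simp
  qed
qed

section \<open>Existence of large sparse families\<close>

lemma sparse_if_d_le_1:
  assumes "d \<le> 1"
  shows "sparse s E"
  unfolding sparse_def
proof (intro allI impI)
  fix X assume X: "X \<subseteq> E" "X \<noteq> {} \<and> card X \<le> s"
  have fX: "finite X" using X finE finite_subset by blast
  show "d * card X + 1 \<le> card (\<Union>(N ` X)) + card X"
  \<comment> \<open>For \<open>d = 0\<close> it suffices that \<open>X\<close> is nonempty; for
    \<open>d = 1\<close> it suffices that its union is nonempty.\<close>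
  proof (cases "d = 0")
    case True
    then show ?thesis using X fX by (simp add: Suc_le_eq card_gt_0_iff)
  next
    case False
    then have "d = 1" using assms by simp
    obtain x where x: "x \<in> X" using X by blast
    have "finite (\<Union>(N ` X))" using X fX finN by blast
    then have "card (N x) \<le> card (\<Union>(N ` X))" using x by (intro card_mono) auto
    then show ?thesis using \<open>d = 1\<close> card_N[of x] x X by auto
  qed
qed

text \<open>The three terms bound the family itself, the hyperedges meeting a saturated vertex, and
  the conflicting ones. Everything is multiplied by \<open>D\<close> to stay in the natural
  numbers.\<close>

lemma maximal_sparse:
  assumes "2 \<le> d" and q: "s * (d * d) \<le> q"
  obtains A where "A \<subseteq> E" "sparse s A"
    "D * card E \<le> D * card A + d * card A * card V + D * (card V * (\<Sum>k\<le>q. (D * d) ^ k))"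
proof -
  define F where "F = {A. A \<subseteq> E \<and> sparse s A \<and> (\<forall>v\<in>V. deg A v \<le> D)}"
  have "finite F" unfolding F_def using finE by simp
  moreover have "{} \<in> F" by (auto simp: F_def sparse_def deg_def)
  ultimately obtain A where A: "A \<in> F" and max: "\<And>B. B \<in> F \<Longrightarrow> A \<subseteq> B \<Longrightarrow> A = B"
    using finite_has_maximal[of F] by blast
  then have AE: "A \<subseteq> E" and sp: "sparse s A" and dA: "\<And>v. v \<in> V \<Longrightarrow> deg A v \<le> D"
    by (auto simp: F_def)
  have fA: "finite A" using AE finE finite_subset by blast
  define S where "S = {v \<in> V. D \<le> deg A v}"
  define M where "M = {e \<in> E. N e \<inter> S \<noteq> {}}"
  define K where "K = {e \<in> E. conflict q A e}"
  \<comment> \<open>Any other hyperedge could be added to \<open>A\<close> within \<open>F\<close>,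
    against maximality.\<close>
  have "E \<subseteq> A \<union> M \<union> K"
  proof (rule ccontr)
    assume "\<not> ?thesis"
    then obtain e where e: "e \<in> E" "e \<notin> A" "N e \<inter> S = {}" "\<not> conflict q A e"
      by (auto simp: M_def K_def)
    have "sparse s (insert e A)" using sparse_insert[OF AE e(1,2) sp e(4) q] .
    moreover have "deg (insert e A) v \<le> D" if "v \<in> V" for v
    proof (cases "v \<in> N e")
      case True
      \<comment> \<open>Since \<open>e\<close> avoids \<open>S\<close>, each of its vertices has
        room for one more hyperedge.\<close>
      then have "deg A v < D" using e(3) that unfolding S_def by auto
      moreover have "{f \<in> insert e A. v \<in> N f} = insert e {f \<in> A. v \<in> N f}" using True by auto
      ultimately show ?thesis unfolding deg_def using fA e(2) by simp
    next
      case False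
      then have "{f \<in> insert e A. v \<in> N f} = {f \<in> A. v \<in> N f}" by auto
      then show ?thesis using dA[OF that] by (simp add: deg_def)
    qed
    ultimately have "insert e A \<in> F" using AE e(1) by (simp add: F_def)
    then show False using max e(2) by blast
  qed
  then have "card E \<le> card (A \<union> M \<union> K)"
    using fA finE by (intro card_mono) (auto simp: M_def K_def)
  also have "\<dots> \<le> card A + card M + card K"
    using card_Un_le[of "A \<union> M" K] card_Un_le[of A M] by linarith
  finally have "D * card E \<le> D * card A + D * card M + D * card K"
    by (metis distrib_left mult_le_mono2)
  moreover have "D * card M \<le> d * card A * card V"
  proof -
    have "card M \<le> card S * card V"
      unfolding M_def using assms(1) by (rule card_meeting_le) (simp add: S_def)
    then have "D * card M \<le> (D * card S) * card V" by (simp add: mult.assoc)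
    also have "\<dots> \<le> (d * card A) * card V"
      unfolding S_def using card_saturated[OF AE] by (rule mult_le_mono1)
    finally show ?thesis .
  qed
  moreover have "D * card K \<le> D * (card V * (\<Sum>k\<le>q. (D * d) ^ k))"
    unfolding K_def by (intro mult_le_mono2 card_conflict_le AE dA)
  ultimately have "D * card E \<le> D * card A + d * card A * card V
      + D * (card V * (\<Sum>k\<le>q. (D * d) ^ k))" by linarith
  then show thesis using that AE sp by blast
qed

text \<open>All constants depend on \<open>C\<close>, \<open>c\<close> and \<open>s\<close> only,
  with \<open>b\<close> standing in for the degree, so one threshold serves a whole family of
  graphs. \<open>D\<close> is large enough for the saturated term to take at most half of the total,
  and its \<open>+ 1\<close> makes it positive.\<close>

lemma large_sparse:
  fixes C c :: real and s b :: nat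
  defines "b \<equiv> nat \<lceil>C\<rceil>"
  defines "D \<equiv> nat \<lceil>2 * C * real b * c\<rceil> + 1"
  assumes C: "0 < C" and c: "0 < c"
    and dense: "(real (card V))\<^sup>2 \<le> C * real (card E)"
    and large: "2 * C * (c + real (\<Sum>k\<le>s * (b * b). (D * b) ^ k)) < real (card V)"
  obtains A where "A \<subseteq> E" "sparse s A" "c * real (card V) \<le> real (card A)"
proof -
  let ?m = "real (card V)" and ?n = "real (card E)"
  define K where "K = real (\<Sum>k\<le>s * (b * b). (D * b) ^ k)"
  have K0: "0 \<le> K" unfolding K_def by (rule of_nat_0_le_iff)
  have m: "2 * C * (c + K) < ?m" using large by (simp add: K_def)
  have "0 < 2 * C * (c + K)" using C c K0 by (intro mult_pos_pos) auto
  then have m0: "0 < ?m" using m by linarith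
  have b: "C \<le> real b" unfolding b_def by linarith
  have D: "2 * C * real b * c \<le> real D" "0 < D" unfolding D_def by linarith+
  show thesis
  proof (cases "d \<le> 1")
    case True
    \<comment> \<open>Here all of \<open>E\<close> is sparse, so only \<open>c * ?m \<le> ?n\<close>
      is needed; it follows from \<open>dense\<close> once \<open>?m\<close> is large.\<close>
    have "(2 * C * (c + K)) * ?m \<le> ?m * ?m" using m m0 by (intro mult_right_mono) auto
    also have "\<dots> \<le> C * ?n" using dense by (simp add: power2_eq_square)
    finally have "C * (2 * (c + K) * ?m) \<le> C * ?n" by (simp add: algebra_simps)
    then have "2 * (c + K) * ?m \<le> ?n" using C by simp
    moreover have "c * ?m \<le> 2 * (c + K) * ?m" using c K0 m0 by (intro mult_right_mono) auto
    ultimately have "c * ?m \<le> ?n" by linarith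
    then show thesis using that sparse_if_d_le_1[OF True] by blast
  next
    case False
    then have d2: "2 \<le> d" by simp
    have "0 < ?m\<^sup>2" using m0 by simp
    then have n0: "0 < ?n" using dense C by (smt (verit) mult_nonneg_nonpos)
    have "real d * ?n \<le> ?m\<^sup>2"
      using card_E_le[OF d2] unfolding power2_eq_square of_nat_mult[symmetric] of_nat_le_iff .
    then have "real d * ?n \<le> C * ?n" using dense by linarith
    then have "real d \<le> C" using n0 by simp
    then have db: "d \<le> b" using b by linarith
    have "s * (d * d) \<le> s * (b * b)" using db by (simp add: mult_le_mono)
    from maximal_sparse[OF d2 this, of D] obtain A where A: "A \<subseteq> E" "sparse s A"
      "D * card E \<le> D * card A + d * card A * card V
        + D * (card V * (\<Sum>k\<le>s * (b * b). (D * d) ^ k))" by blast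
    have "c * ?m \<le> real (card A)"
    proof (rule ccontr)
      assume "\<not> ?thesis"
      then have small: "real (card A) \<le> c * ?m" by simp
      have "(\<Sum>k\<le>s * (b * b). (D * d) ^ k) \<le> (\<Sum>k\<le>s * (b * b). (D * b) ^ k)"
        using db by (intro sum_mono power_mono) auto
      moreover define K' where "K' = real (\<Sum>k\<le>s * (b * b). (D * d) ^ k)"
      ultimately have K: "0 \<le> K'" "K' \<le> K"
        unfolding K_def by (simp_all only: of_nat_le_iff of_nat_0_le_iff)
      have "real D * ?n \<le> real D * real (card A) + real d * real (card A) * ?m
          + real D * (?m * K')"
        using of_nat_mono[OF A(3), where 'a = real] unfolding K'_def of_nat_add of_nat_mult .
      also have "\<dots> \<le> real D * (c * ?m) + real b * (c * ?m) * ?m + real D * (?m * K)"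
        using small K db c m0 by (intro add_mono mult_mono) auto
      finally have 1: "real D * ?n \<le> real D * (c + K) * ?m + real b * c * ?m\<^sup>2"
        by (simp add: algebra_simps power2_eq_square)
      have "real D * ?m\<^sup>2 \<le> real D * (C * ?n)" using dense by (intro mult_left_mono) auto
      also have "\<dots> = C * (real D * ?n)" by simp
      also have "\<dots> \<le> C * (real D * (c + K) * ?m + real b * c * ?m\<^sup>2)"
        using 1 C by (intro mult_left_mono) auto
      \<comment> \<open>Doubling produces the coefficient \<open>2 * C * real b * c\<close>, which
        is at most \<open>D\<close>; one copy of \<open>real D * ?m\<^sup>2\<close> then
        cancels.\<close>
      finally have "2 * (real D * ?m\<^sup>2)
          \<le> real D * (2 * C * (c + K) * ?m) + (2 * C * real b * c) * ?m\<^sup>2"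
        by (simp add: algebra_simps)
      also have "\<dots> \<le> real D * (2 * C * (c + K) * ?m) + real D * ?m\<^sup>2"
        using D(1) by (intro add_left_mono mult_right_mono) auto
      finally have "real D * ?m\<^sup>2 \<le> real D * (2 * C * (c + K) * ?m)" by simp
      then have "?m\<^sup>2 \<le> 2 * C * (c + K) * ?m" using D(2) by simp
      then have "?m \<le> 2 * C * (c + K)" using m0 by (simp add: power2_eq_square)
      then show False using m by simp
    qed
    then show thesis using that A by blast
  qed
qed

end

section \<open>From bipartite graphs to linear hypergraphs\<close>

lemma finite_bipartite:
  assumes "bipartite_graph G"
  shows "finite (left G)" "finite (right G)"
  using assms by (auto simp: bipartite_graph_def)

text \<open>Regularity counts edges as unordered pairs; sending a neighbour \<open>v\<close> to
  \<open>{u, v}\<close> is a bijection onto the edges at \<open>u\<close>.\<close>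

lemma card_neighbourhood_singleton:
  assumes "bipartite_graph G" "left_regular G d" "u \<in> left G"
  shows "card (neighbourhood G {u}) = d"
proof -
  have "bij_betw (\<lambda>v. {u, v}) (neighbourhood G {u}) {e \<in> edges G. u \<in> e}"
  proof (rule bij_betw_imageI)
    show "inj_on (\<lambda>v. {u, v}) (neighbourhood G {u})"
      by (auto simp: inj_on_def doubleton_eq_iff)
    show "(\<lambda>v. {u, v}) ` neighbourhood G {u} = {e \<in> edges G. u \<in> e}"
    proof (intro equalityI subsetI)
      fix e assume "e \<in> {e \<in> edges G. u \<in> e}"
      moreover then obtain x y where xy: "x \<in> left G" "y \<in> right G" "e = {x, y}"
        using assms(1) unfolding bipartite_graph_def by blast
      ultimately have "x = u" using assms(1,3) unfolding bipartite_graph_def by blast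
      then show "e \<in> (\<lambda>v. {u, v}) ` neighbourhood G {u}"
        using xy \<open>e \<in> {e \<in> edges G. u \<in> e}\<close> by (auto simp: neighbourhood_def)
    qed (auto simp: neighbourhood_def)
  qed
  then have "card (neighbourhood G {u}) = card {e \<in> edges G. u \<in> e}" by (rule bij_betw_same_card)
  then show ?thesis using assms(2,3) by (simp add: left_regular_def)
qed

lemma neighbourhood_UN: "neighbourhood G X = (\<Union>u\<in>X. neighbourhood G {u})"
  by (auto simp: neighbourhood_def)

text \<open>These access \<open>Min\<close> through its defining set, finite because
  \<open>left G\<close> has finitely many subsets. For the lower bound it must also be nonempty,
  which a singleton ensures.\<close>

lemma
  assumes "finite (left G)"
  shows expansion_le: "X \<subseteq> left G \<Longrightarrow> 0 < card X \<Longrightarrow> card X \<le> t \<Longrightarrow>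
      expansion G t \<le> real (card (neighbourhood G X)) / real (card X)"
    and expansion_ge: "1 \<le> t \<Longrightarrow> t \<le> card (left G) \<Longrightarrow>
      (\<And>X. X \<subseteq> left G \<Longrightarrow> 0 < card X \<Longrightarrow> card X \<le> t \<Longrightarrow>
        x \<le> real (card (neighbourhood G X)) / real (card X)) \<Longrightarrow> x \<le> expansion G t"
proof -
  let ?S = "{real (card (neighbourhood G X)) / real (card X) | X.
            X \<subseteq> left G \<and> 0 < card X \<and> card X \<le> t}"
  have "?S \<subseteq> (\<lambda>X. real (card (neighbourhood G X)) / real (card X)) ` Pow (left G)" by auto
  then have fS: "finite ?S" using assms by (meson finite_Pow_iff finite_imageI finite_subset)
  show "expansion G t \<le> real (card (neighbourhood G X)) / real (card X)"
    if "X \<subseteq> left G" "0 < card X" "card X \<le> t"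
    unfolding expansion_def by (rule Min_le[OF fS]) (use that in blast)
  show "x \<le> expansion G t" if t: "1 \<le> t" "t \<le> card (left G)" and
    X: "\<And>X. X \<subseteq> left G \<Longrightarrow> 0 < card X \<Longrightarrow> card X \<le> t \<Longrightarrow>
        x \<le> real (card (neighbourhood G X)) / real (card X)"
  proof -
    obtain u where "u \<in> left G" using t by fastforce
    then have "real (card (neighbourhood G {u})) / real (card {u}) \<in> ?S" using t(1)
      by (intro CollectI exI[of _ "{u}"]) auto
    then have "?S \<noteq> {}" by blast
    then show ?thesis unfolding expansion_def using fS X by (subst Min_ge_iff) auto
  qed
qed

text \<open>At $t = 2$ the expansion bound gives two left vertices at least $2d - 1$ neighbours
  together; with $d$ neighbours each, they share at most one.\<close>

lemma two_optimal_imp_linear_hypergraph: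
  assumes bp: "bipartite_graph G" and lr: "left_regular G d"
    and opt: "optimal_small_set_expander G d 2"
  shows "linear_hypergraph (left G) (right G) (\<lambda>u. neighbourhood G {u}) d"
proof
  show "finite (left G)" "finite (right G)" using finite_bipartite[OF bp] by auto
  fix u assume u: "u \<in> left G"
  show "neighbourhood G {u} \<subseteq> right G" by (auto simp: neighbourhood_def)
  show "card (neighbourhood G {u}) = d" by (rule card_neighbourhood_singleton[OF bp lr u])
  fix w assume w: "w \<in> left G" "u \<noteq> w"
  let ?N = "\<lambda>u. neighbourhood G {u}"
  have "real d - 1 + 1 / real 2 \<le> expansion G 2"
    using opt one_le_numeral unfolding optimal_small_set_expander_def by blast
  also have "\<dots> \<le> real (card (neighbourhood G {u, w})) / real (card {u, w})"
    using u w by (intro expansion_le finite_bipartite[OF bp]) auto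
  also have "neighbourhood G {u, w} = ?N u \<union> ?N w" by (auto simp: neighbourhood_def)
  finally have "2 * real d - 1 \<le> real (card (?N u \<union> ?N w))" using w by simp
  moreover have "card (?N u) + card (?N w) = card (?N u \<union> ?N w) + card (?N u \<inter> ?N w)"
    using finite_bipartite(2)[OF bp] by (intro card_Un_Int) (auto simp: neighbourhood_def)
  ultimately show "card (?N u \<inter> ?N w) \<le> 1"
    using card_neighbourhood_singleton[OF bp lr] u w by simp
qed

section \<open>Restriction to a set of left vertices\<close>

definition left_restrict :: "'a bigraph \<Rightarrow> 'a set \<Rightarrow> 'a bigraph" where
  "left_restrict G A = \<lparr>left = A, right = right G, edges = {e \<in> edges G. e \<inter> A \<noteq> {}}\<rparr>"

lemma left_restrict_simps [simp]:
  "left (left_restrict G A) = A" "right (left_restrict G A) = right G"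
  by (simp_all add: left_restrict_def)

text \<open>The right part is disjoint from \<open>A\<close>, so an edge meeting \<open>A\<close>
  does so in its left endpoint.\<close>

lemma left_restrict_subgraph:
  assumes "bipartite_graph G" "A \<subseteq> left G"
  shows "bipartite_subgraph (left_restrict G A) G"
proof -
  have "\<exists>u\<in>A. \<exists>v\<in>right G. e = {u, v}" if e: "e \<in> edges G" "e \<inter> A \<noteq> {}" for e
  proof -
    obtain u v where uv: "u \<in> left G" "v \<in> right G" "e = {u, v}"
      using assms(1) e(1) unfolding bipartite_graph_def by blast
    then have "v \<notin> A" using assms unfolding bipartite_graph_def by blast
    then show ?thesis using uv e(2) by blast
  qed
  then show ?thesis
    using assms finite_subset[OF assms(2)]
    unfolding bipartite_subgraph_def bipartite_graph_def left_restrict_def by auto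
qed

lemma left_regular_left_restrict:
  assumes "left_regular G d" "A \<subseteq> left G"
  shows "left_regular (left_restrict G A) d"
proof -
  have "{e \<in> edges (left_restrict G A). u \<in> e} = {e \<in> edges G. u \<in> e}" if "u \<in> A" for u
    using that by (auto simp: left_restrict_def)
  then show ?thesis using assms unfolding left_regular_def by auto
qed

lemma neighbourhood_left_restrict:
  "X \<subseteq> A \<Longrightarrow> neighbourhood (left_restrict G A) X = neighbourhood G X"
  by (auto simp: left_restrict_def neighbourhood_def)

lemma optimal_left_restrict:
  assumes bp: "bipartite_graph G" and lr: "left_regular G d" and A: "A \<subseteq> left G"
    and s: "s \<le> card A"
    and sparse: "\<And>X. X \<subseteq> A \<Longrightarrow> 0 < card X \<Longrightarrow> card X \<le> s \<Longrightarrow>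
      d * card X + 1 \<le> card (neighbourhood G X) + card X"
  shows "optimal_small_set_expander (left_restrict G A) d s"
proof -
  have sub: "bipartite_subgraph (left_restrict G A) G" by (rule left_restrict_subgraph[OF bp A])
  have fA: "finite A" using A finite_bipartite(1)[OF bp] finite_subset by blast
  have "real d - 1 + 1 / real t \<le> expansion (left_restrict G A) t" if t: "1 \<le> t" "t \<le> s" for t
  proof (rule expansion_ge)
    fix X assume X: "X \<subseteq> left (left_restrict G A)" "0 < card X" "card X \<le> t"
    have "d * card X + 1 \<le> card (neighbourhood G X) + card X"
      using X t by (intro sparse) auto
    then have "real (d * card X + 1) \<le> real (card (neighbourhood G X) + card X)"
      by (rule of_nat_mono)
    then have "(real d - 1) * real (card X) + 1 \<le> real (card (neighbourhood G X))"
      by (simp add: algebra_simps)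
    then have "((real d - 1) * real (card X) + 1) / real (card X)
        \<le> real (card (neighbourhood G X)) / real (card X)"
      by (rule divide_right_mono) simp
    then have "real d - 1 + 1 / real (card X) \<le> real (card (neighbourhood G X)) / real (card X)"
      using X(2) by (simp add: add_divide_distrib)
    moreover have "1 / real t \<le> 1 / real (card X)" using X by (simp add: frac_le)
    ultimately show "real d - 1 + 1 / real t
        \<le> real (card (neighbourhood (left_restrict G A) X)) / real (card X)"
      using X(1) by (simp add: neighbourhood_left_restrict)
  qed (use t s fA in auto)
  then show ?thesis
    using sub s left_regular_left_restrict[OF lr A]
    unfolding optimal_small_set_expander_def bipartite_subgraph_def by simp
qed

section \<open>A common threshold for the family of graphs\<close>

theorem theorem1p6:
  fixes G :: "nat \<Rightarrow> 'a bigraph" and d n m :: "nat \<Rightarrow> nat"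
  assumes "\<And>k. bipartite_graph (G k)"
    and "\<And>k. left_regular (G k) (d k)"
    and "\<And>k. optimal_small_set_expander (G k) (d k) 2"
    and "\<And>k. n k = card (left (G k))"
    and "\<And>k. m k = card (right (G k))"
    and "Bseq (\<lambda>k. (real (m k))\<^sup>2 / real (n k))"
    and "filterlim m at_top sequentially"
  shows "\<forall>s c. 3 \<le> (s::nat) \<and> 1 < (c::real) \<longrightarrow>
    (\<exists>k0. \<forall>k\<ge>k0. \<exists>A. bipartite_subgraph A (G k) \<and>
       left_regular A (d k) \<and>
       real (card (left A)) \<ge> c * real (m k) \<and>
       c * real (m k) \<ge> c * real (card (right A)) \<and>
       optimal_small_set_expander A (d k) s)"
proof (intro allI impI, elim conjE)
  fix s :: nat and c :: real
  assume c: "1 < c"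
  obtain C where C: "0 < C" and bound: "\<And>k. norm ((real (m k))\<^sup>2 / real (n k)) \<le> C"
    using assms(6) by (auto elim: BseqE)
  have dense: "(real (m k))\<^sup>2 \<le> C * real (n k)" for k
  proof -
    \<comment> \<open>The size bound in 2-optimality makes \<open>n k\<close> positive, so the
      quotient can be multiplied out.\<close>
    have "2 \<le> n k" using assms(3)[of k] assms(4)[of k] by (simp add: optimal_small_set_expander_def)
    then show ?thesis using bound[of k] by (simp add: field_simps)
  qed
  define b where "b = nat \<lceil>C\<rceil>"
  define D where "D = nat \<lceil>2 * C * real b * c\<rceil> + 1"
  define M where "M = 2 * C * (c + real (\<Sum>k\<le>s * (b * b). (D * b) ^ k))"
  \<comment> \<open>The \<open>+ 1\<close> gives the strict inequality
    \<open>M < real (m k)\<close>; the \<open>+ s\<close> later yields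
    \<open>s \<le> card A\<close>, which s-optimality includes.\<close>
  have "\<forall>\<^sub>F k in sequentially. nat \<lceil>M\<rceil> + 1 + s \<le> m k"
    using assms(7) unfolding filterlim_at_top by blast
  then obtain k0 where k0: "\<And>k. k \<ge> k0 \<Longrightarrow> nat \<lceil>M\<rceil> + 1 + s \<le> m k"
    unfolding eventually_sequentially by blast
  show "\<exists>k0. \<forall>k\<ge>k0. \<exists>A. bipartite_subgraph A (G k) \<and> left_regular A (d k) \<and>
       real (card (left A)) \<ge> c * real (m k) \<and> c * real (m k) \<ge> c * real (card (right A)) \<and>
       optimal_small_set_expander A (d k) s"
  proof (intro exI[of _ k0] allI impI)
    fix k assume "k0 \<le> k"
    interpret linear_hypergraph "left (G k)" "right (G k)" "\<lambda>u. neighbourhood (G k) {u}" "d k"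
      by (rule two_optimal_imp_linear_hypergraph[OF assms(1-3)])
    have mk: "M < real (m k)" "s \<le> m k" using k0[OF \<open>k0 \<le> k\<close>] by linarith+
    obtain A where A: "A \<subseteq> left (G k)" "sparse s A" "c * real (m k) \<le> real (card A)"
    proof (rule large_sparse[of C c s])
      show "(real (card (right (G k))))\<^sup>2 \<le> C * real (card (left (G k)))"
        using dense[of k] assms(4,5)[of k] by simp
      show "2 * C * (c + real (\<Sum>j\<le>s * (nat \<lceil>C\<rceil> * nat \<lceil>C\<rceil>).
          ((nat \<lceil>2 * C * real (nat \<lceil>C\<rceil>) * c\<rceil> + 1) * nat \<lceil>C\<rceil>) ^ j)) < real (card (right (G k)))"
        using mk(1) assms(5)[of k] unfolding M_def D_def b_def by simp
    qed (use C c assms(5)[of k] in auto)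
    have "real (m k) \<le> c * real (m k)" using c by (simp add: mult_le_cancel_right1)
    then have "s \<le> card A" using A(3) mk(2) by linarith
    then have "optimal_small_set_expander (left_restrict (G k) A) (d k) s"
    proof (rule optimal_left_restrict[OF assms(1,2) A(1)])
      fix X assume X: "X \<subseteq> A" "0 < card X" "card X \<le> s"
      then have "X \<noteq> {}" by auto
      then show "d k * card X + 1 \<le> card (neighbourhood (G k) X) + card X"
        using A(2) X unfolding sparse_def by (subst neighbourhood_UN) blast
    qed
    then show "\<exists>A. bipartite_subgraph A (G k) \<and> left_regular A (d k) \<and>
       real (card (left A)) \<ge> c * real (m k) \<and> c * real (m k) \<ge> c * real (card (right A)) \<and>
       optimal_small_set_expander A (d k) s"
      using left_restrict_subgraph[OF assms(1) A(1)] left_regular_left_restrict[OF assms(2) A(1)]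
        A(3) assms(5)[of k]
      \<comment> \<open>The restriction keeps the whole right part, so the second inequality in the
        size condition is an equality.\<close>
      by (intro exI[of _ "left_restrict (G k) A"]) auto
  qed
qed

end
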